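(* Let $\{T_i\}_{i\in I}$ be a $p$-frame associated to $(a_2,\dots,a_n)$ for $X$ with bounds $A,B$, and let $\{R_i\}_{i\in I}\subseteq X_F^{*}$ be any sequence. Let $\{\alpha_i\}_{i\in I},\{\beta_i\}_{i\in I}\subset\mathbb R$ be any two positively confined sequences such that, for all $x\in X$, $$\sum_{i\in I}\big|\alpha_iT_i(x,a_2,\dots,a_n)-\beta_iR_i(x,a_2,\dots,a_n)\big|^p\le\lambda\sum_{i\in I}|\alpha_iT_i(x,a_2,\dots,a_n)|^p+\mu\sum_{i\in I}|\beta_iR_i(x,a_2,\dots,a_n)|^p,$$ where $\lambda,\mu$ are constants with $0\le\lambda,\mu<\frac1{2^p}$. Then $\{R_i\}_{i\in I}$ is a $p$-frame associated to $(a_2,\dots,a_n)$ for $X$.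
   Context: Let $\mathbb K$ be the field of real or complex numbers, $n\ge 2$, $1<p<\infty$, and let $I$ be a countable index set. An $n$-norm on a linear space $X$ over $\mathbb K$ is a map $\|\cdot,\dots,\cdot\|_X:X^n\to\mathbb R$ such that (i) $\|x_1,\dots,x_n\|_X=0$ if and only if $x_1,\dots,x_n$ are linearly dependent; (ii) it is invariant under permutations of its arguments; (iii) $\|\alpha x_1,x_2,\dots,x_n\|_X=|\alpha|\,\|x_1,\dots,x_n\|_X$ for $\alpha\in\mathbb K$; (iv) $\|x+y,x_2,\dots,x_n\|_X\le\|x,x_2,\dots,x_n\|_X+\|y,x_2,\dots,x_n\|_X$. A sequence $\{x_k\}$ converges to $x$ if $\|x_k-x,x_2,\dots,x_n\|_X\to0$ for all $x_2,\dots,x_n\in X$, and is Cauchy if $\|x_l-x_k,x_2,\dots,x_n\|_X\to0$ as $l,k\to\infty$ for all $x_2,\dots,x_n\in X$; $X$ is an $n$-Banach space if every Cauchy sequence in $X$ converges in $X$. Throughout, $X$ is an $n$-Banach space and $a_2,\dots,a_n\in X$ are fixed. A bounded $b$-linear functional on $X\times\langle a_2\rangle\times\cdots\times\langle a_n\rangle$ ($\langle a_i\rangle$ is the subspace generated by $a_i$) is a map $T$ from this set to $\mathbb K$ with $T(x+y,a_2,\dots,a_n)=T(x,a_2,\dots,a_n)+T(y,a_2,\dots,a_n)$ and $T(kx,a_2,\dots,a_n)=k\,T(x,a_2,\dots,a_n)$ for all $x,y\in X$, $k\in\mathbb K$, and for which there is $M>0$ with $|T(x,a_2,\dots,a_n)|\le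 M\|x,a_2,\dots,a_n\|_X$ for all $x\in X$. $X_F^{*}$ is the Banach space of all such functionals, the norm of $T$ being the infimum of such $M$. A countable family $\{T_i\}_{i\in I}\subseteq X_F^{*}$ is a $p$-frame associated to $(a_2,\dots,a_n)$ for $X$ (with bounds $A,B$) if there are constants $A,B>0$ with $A\|x,a_2,\dots,a_n\|_X^p\le\sum_{i\in I}|T_i(x,a_2,\dots,a_n)|^p\le B\|x,a_2,\dots,a_n\|_X^p$ for all $x\in X$. A real sequence $\{\alpha_i\}_{i\in I}$ is positively confined if $0<\inf_i\alpha_i\le\sup_i\alpha_i<\infty$.
   Formalization: The series on the left of the perturbation inequality is assumed to converge for every x; if infinite sums are allowed (∞ ≤ ∞ with μ > 0) the claim fails, e.g. T_i = 2^{-i}f, R_i = f with |f(x)| = ‖x,a_2,…,a_n‖. *)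

theory Defs
  imports "HOL-Analysis.Analysis" "HOL-Library.Multiset"
begin

text \<open>
  The scalar field is a type \<open>'k\<close> of class \<^class>\<open>real_normed_field\<close>. Besides \<^typ>\<open>real\<close> and
  \<^typ>\<open>complex\<close> this admits, by the Gelfand-Mazur theorem, only isomorphic copies of these two.
  The space \<open>X\<close> is the whole type \<open>'v\<close>. A tuple is a list, so \<open>(x, a\<^sub>2, \<dots>, a\<^sub>n)\<close> is \<open>x # a\<close>
  with \<open>length a = n - 1\<close>.
\<close>

text \<open>Dependence of a list as a family: a list with a repeated entry is dependent.\<close>

definition lin_dep_list :: "('k::field \<Rightarrow> 'v::ab_group_add \<Rightarrow> 'v) \<Rightarrow> 'v list \<Rightarrow> bool" where
  "lin_dep_list smul xs \<longleftrightarrow>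
     (\<exists>c. (\<exists>i<length xs. c i \<noteq> 0) \<and> (\<Sum>i<length xs. smul (c i) (xs ! i)) = 0)"

locale n_normed_space = vector_space smul
  for smul :: "'k::real_normed_field \<Rightarrow> 'v::ab_group_add \<Rightarrow> 'v" +
  fixes n :: nat
    and nnorm :: "'v list \<Rightarrow> real"
  assumes n_ge_2: "n \<ge> 2"
    and nnorm_eq_0_iff: "length xs = n \<Longrightarrow> nnorm xs = 0 \<longleftrightarrow> lin_dep_list smul xs"
    and nnorm_perm: "length xs = n \<Longrightarrow> mset ys = mset xs \<Longrightarrow> nnorm ys = nnorm xs"
    and nnorm_scale: "length xs = n - 1 \<Longrightarrow> nnorm (smul c x # xs) = norm c * nnorm (x # xs)"
    and nnorm_triangle: "length xs = n - 1 \<Longrightarrow>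
          nnorm ((x + y) # xs) \<le> nnorm (x # xs) + nnorm (y # xs)"

definition n_converges :: "nat \<Rightarrow> ('v::ab_group_add list \<Rightarrow> real) \<Rightarrow> (nat \<Rightarrow> 'v) \<Rightarrow> 'v \<Rightarrow> bool" where
  "n_converges n nnorm u x \<longleftrightarrow>
     (\<forall>xs. length xs = n - 1 \<longrightarrow> (\<lambda>k. nnorm ((u k - x) # xs)) \<longlonglongrightarrow> 0)"

definition n_Cauchy :: "nat \<Rightarrow> ('v::ab_group_add list \<Rightarrow> real) \<Rightarrow> (nat \<Rightarrow> 'v) \<Rightarrow> bool" where
  "n_Cauchy n nnorm u \<longleftrightarrow>
     (\<forall>xs. length xs = n - 1 \<longrightarrow>
        ((\<lambda>(l, k). nnorm ((u l - u k) # xs)) \<longlongrightarrow> 0) (sequentially \<times>\<^sub>F sequentially))"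

locale n_Banach_space = n_normed_space +
  assumes n_complete: "n_Cauchy n nnorm u \<Longrightarrow> \<exists>x. n_converges n nnorm u x"

definition b_domain ::
  "('k::field \<Rightarrow> 'v::ab_group_add \<Rightarrow> 'v) \<Rightarrow> 'v list \<Rightarrow> 'v list set" where
  "b_domain smul a = {x # b | x b. list_all2 (\<lambda>y z. y \<in> module.span smul {z}) b a}"

text \<open>
  The set \<open>X\<^sub>F\<^sup>*\<close>. A map on \<^const>\<open>b_domain\<close> is represented by its extension that is
  \<^const>\<open>undefined\<close> elsewhere.
\<close>

definition bounded_b_linear ::
  "('k::real_normed_field \<Rightarrow> 'v::ab_group_add \<Rightarrow> 'v) \<Rightarrow> ('v list \<Rightarrow> real) \<Rightarrow> 'v list
    \<Rightarrow> ('v list \<Rightarrow> 'k) set" where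
  "bounded_b_linear smul nnorm a =
     {T \<in> b_domain smul a \<rightarrow>\<^sub>E UNIV.
        (\<forall>x y. T ((x + y) # a) = T (x # a) + T (y # a)) \<and>
        (\<forall>k x. T (smul k x # a) = k * T (x # a)) \<and>
        (\<exists>M>0. \<forall>x. norm (T (x # a)) \<le> M * nnorm (x # a))}"

text \<open>The upper frame inequality entails convergence of the series, stated here explicitly
  because \<^const>\<open>infsum\<close> is \<open>0\<close> for a divergent real series.\<close>

definition p_frame_with_bounds ::
  "('k::real_normed_field \<Rightarrow> 'v::ab_group_add \<Rightarrow> 'v) \<Rightarrow> ('v list \<Rightarrow> real) \<Rightarrow> 'v list \<Rightarrow> real
    \<Rightarrow> 'i set \<Rightarrow> ('i \<Rightarrow> 'v list \<Rightarrow> 'k) \<Rightarrow> real \<Rightarrow> real \<Rightarrow> bool" where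
  "p_frame_with_bounds smul nnorm a p I T A B \<longleftrightarrow>
     countable I \<and> (\<forall>i\<in>I. T i \<in> bounded_b_linear smul nnorm a) \<and> A > 0 \<and> B > 0 \<and>
     (\<forall>x. (\<lambda>i. norm (T i (x # a)) powr p) summable_on I \<and>
          A * nnorm (x # a) powr p \<le> (\<Sum>\<^sub>\<infinity>i\<in>I. norm (T i (x # a)) powr p) \<and>
          (\<Sum>\<^sub>\<infinity>i\<in>I. norm (T i (x # a)) powr p) \<le> B * nnorm (x # a) powr p)"

definition p_frame ::
  "('k::real_normed_field \<Rightarrow> 'v::ab_group_add \<Rightarrow> 'v) \<Rightarrow> ('v list \<Rightarrow> real) \<Rightarrow> 'v list \<Rightarrow> real
    \<Rightarrow> 'i set \<Rightarrow> ('i \<Rightarrow> 'v list \<Rightarrow> 'k) \<Rightarrow> bool" where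
  "p_frame smul nnorm a p I T \<longleftrightarrow> (\<exists>A B. p_frame_with_bounds smul nnorm a p I T A B)"

text \<open>
  Infimum and supremum are taken in \<^typ>\<open>ereal\<close>, where they always exist. The inequality between
  them is automatic for nonempty \<open>I\<close> and omitted, so that the empty family is not excluded.
\<close>

definition positively_confined :: "'i set \<Rightarrow> ('i \<Rightarrow> real) \<Rightarrow> bool" where
  "positively_confined I \<alpha> \<longleftrightarrow> 0 < (INF i\<in>I. ereal (\<alpha> i)) \<and> (SUP i\<in>I. ereal (\<alpha> i)) < \<infinity>"

end

theory Submission
  imports Defs
begin

text \<open>
  For fixed \<open>x\<close> write \<open>S\<^sub>T\<close>, \<open>S\<^sub>R\<close> and \<open>D\<close> for the sums over \<open>i\<close> of the \<open>p\<close>-th powers of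
  the absolute values of \<open>\<alpha>\<^sub>i T\<^sub>i(x, a)\<close>, of \<open>\<beta>\<^sub>i R\<^sub>i(x, a)\<close> and of their difference, so that the
  hypothesis reads \<open>D \<le> \<lambda> S\<^sub>T + \<mu> S\<^sub>R\<close>. The elementary inequality
  \<open>\<bar>u + v\<bar>\<^sup>p \<le> 2\<^sup>p (\<bar>u\<bar>\<^sup>p + \<bar>v\<bar>\<^sup>p)\<close>, summed over the index set (lemma \<open>powr_sum_perturb\<close>), gives
  \<open>S\<^sub>R \<le> 2\<^sup>p (D + S\<^sub>T)\<close> and \<open>S\<^sub>T \<le> 2\<^sup>p (D + S\<^sub>R)\<close>. Inserting the bound on \<open>D\<close> yields
  \<open>(1 - 2\<^sup>p \<mu>) S\<^sub>R \<le> 2\<^sup>p (1 + \<lambda>) S\<^sub>T\<close> and \<open>(1 - 2\<^sup>p \<lambda>) S\<^sub>T \<le> 2\<^sup>p (1 + \<mu>) S\<^sub>R\<close>,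
  where the factors on the left are positive because \<open>\<lambda>\<close> and \<open>\<mu>\<close> are smaller than \<open>1 / 2\<^sup>p\<close>.

  Since the weights lie between two positive constants, \<open>S\<^sub>T\<close> and \<open>S\<^sub>R\<close> are comparable with the
  unweighted power sums of \<open>T\<close> and \<open>R\<close> (lemma \<open>powr_sum_weighted\<close>). Hence the power sums of \<open>R\<close>
  and of \<open>T\<close> are comparable, with constants independent of \<open>x\<close>, and the frame inequalities pass
  from \<open>T\<close> to \<open>R\<close>.
\<close>

lemma positively_confined_bounds:
  assumes "positively_confined I w"
  obtains c C where "0 < c" "0 < C" "\<forall>i\<in>I. c \<le> w i \<and> w i \<le> C"
proof -
  obtain c where c: "0 < ereal c" "ereal c < (INF i\<in>I. ereal (w i))"
    using assms ereal_dense2 unfolding positively_confined_def by blast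
  obtain C where C: "(SUP i\<in>I. ereal (w i)) < ereal C"
    using assms ereal_dense2 unfolding positively_confined_def by blast
  have lo: "c \<le> w i" if "i \<in> I" for i
    using c(2) INF_lower[OF that, of "\<lambda>i. ereal (w i)"] less_le_trans by fastforce
  have up: "w i \<le> C" if "i \<in> I" for i
    using C SUP_upper[OF that, of "\<lambda>i. ereal (w i)"] le_less_trans by fastforce
  show thesis
    \<comment> \<open>For empty \<open>I\<close> the constant \<open>C\<close> may be negative, hence the maximum.\<close>
    by (rule that[of c "max C 1"]) (use c(1) lo up in \<open>auto simp: le_max_iff_disj\<close>)
qed

lemma norm_add_powr_le:
  fixes u v :: "'a::real_normed_vector"
  assumes "0 \<le> p"
  shows "norm (u + v) powr p \<le> 2 powr p * (norm u powr p + norm v powr p)"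
proof -
  have "norm (u + v) powr p \<le> (2 * max (norm u) (norm v)) powr p"
    using norm_triangle_ineq[of u v] assms by (intro powr_mono2) auto
  also have "\<dots> = 2 powr p * max (norm u) (norm v) powr p"
    by (simp add: powr_mult)
  also have "\<dots> \<le> 2 powr p * (norm u powr p + norm v powr p)"
    by (intro mult_left_mono) (auto simp: max_def)
  finally show ?thesis .
qed

lemma powr_sum_perturb:
  fixes u v :: "'i \<Rightarrow> 'a::real_normed_vector"
  assumes "0 \<le> p"
    and d: "(\<lambda>i. norm (u i - v i) powr p) summable_on I"
    and u: "(\<lambda>i. norm (u i) powr p) summable_on I"
  shows powr_summable_perturb: "(\<lambda>i. norm (v i) powr p) summable_on I"
    and powr_infsum_perturb:
      "(\<Sum>\<^sub>\<infinity>i\<in>I. norm (v i) powr p)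
        \<le> 2 powr p * ((\<Sum>\<^sub>\<infinity>i\<in>I. norm (u i - v i) powr p) + (\<Sum>\<^sub>\<infinity>i\<in>I. norm (u i) powr p))"
proof -
  have le: "norm (v i) powr p \<le> 2 powr p * (norm (u i - v i) powr p + norm (u i) powr p)" for i
    using norm_add_powr_le[OF assms(1), of "v i - u i" "u i"] by (simp add: norm_minus_commute)
  have sm: "(\<lambda>i. 2 powr p * (norm (u i - v i) powr p + norm (u i) powr p)) summable_on I"
    by (intro summable_on_cmult_right summable_on_add d u)
  show v: "(\<lambda>i. norm (v i) powr p) summable_on I"
    by (rule summable_on_comparison_test[OF sm]) (use le in auto)
  have "(\<Sum>\<^sub>\<infinity>i\<in>I. norm (v i) powr p)
      \<le> (\<Sum>\<^sub>\<infinity>i\<in>I. 2 powr p * (norm (u i - v i) powr p + norm (u i) powr p))"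
    by (rule infsum_mono[OF v sm le])
  also have "\<dots> = 2 powr p *
      ((\<Sum>\<^sub>\<infinity>i\<in>I. norm (u i - v i) powr p) + (\<Sum>\<^sub>\<infinity>i\<in>I. norm (u i) powr p))"
    by (simp add: infsum_cmult_right' infsum_add[OF d u])
  finally show "(\<Sum>\<^sub>\<infinity>i\<in>I. norm (v i) powr p)
      \<le> 2 powr p * ((\<Sum>\<^sub>\<infinity>i\<in>I. norm (u i - v i) powr p) + (\<Sum>\<^sub>\<infinity>i\<in>I. norm (u i) powr p))" .
qed

lemma powr_sum_weighted:
  fixes f :: "'i \<Rightarrow> 'a::real_normed_algebra_1" and w :: "'i \<Rightarrow> real"
  assumes "0 \<le> p" "0 < c" and w: "\<forall>i\<in>I. c \<le> w i \<and> w i \<le> C"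
  shows powr_summable_weighted_iff:
      "(\<lambda>i. norm (of_real (w i) * f i) powr p) summable_on I \<longleftrightarrow>
        (\<lambda>i. norm (f i) powr p) summable_on I"
    and powr_infsum_weighted_ge:
      "(\<lambda>i. norm (f i) powr p) summable_on I \<Longrightarrow>
        c powr p * (\<Sum>\<^sub>\<infinity>i\<in>I. norm (f i) powr p)
          \<le> (\<Sum>\<^sub>\<infinity>i\<in>I. norm (of_real (w i) * f i) powr p)"
    and powr_infsum_weighted_le:
      "(\<lambda>i. norm (f i) powr p) summable_on I \<Longrightarrow>
        (\<Sum>\<^sub>\<infinity>i\<in>I. norm (of_real (w i) * f i) powr p)
          \<le> C powr p * (\<Sum>\<^sub>\<infinity>i\<in>I. norm (f i) powr p)"
proof -
  have eq: "norm (of_real (w i) * f i) powr p = w i powr p * norm (f i) powr p" if "i \<in> I" for i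
  proof -
    have "0 < w i"
      using assms(2) w that by fastforce
    moreover from this have "norm (of_real (w i) * f i) = w i * norm (f i)"
      by (simp flip: scaleR_conv_of_real)
    ultimately show ?thesis
      by (simp add: powr_mult)
  qed
  have lo: "c powr p * norm (f i) powr p \<le> norm (of_real (w i) * f i) powr p" if "i \<in> I" for i
    unfolding eq[OF that] using assms(1,2) w that
    by (intro mult_right_mono powr_mono2) auto
  have up: "norm (of_real (w i) * f i) powr p \<le> C powr p * norm (f i) powr p" if "i \<in> I" for i
    unfolding eq[OF that] using assms(1,2) w that
    by (intro mult_right_mono powr_mono2) auto
  have fw: "(\<lambda>i. norm (of_real (w i) * f i) powr p) summable_on I"
    if "(\<lambda>i. norm (f i) powr p) summable_on I"
    by (rule summable_on_comparison_test[OF summable_on_cmult_right[OF that, of "C powr p"]])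
      (use up in auto)
  have bw: "(\<lambda>i. norm (f i) powr p) summable_on I"
    if "(\<lambda>i. norm (of_real (w i) * f i) powr p) summable_on I"
  proof -
    have "(\<lambda>i. c powr p * norm (f i) powr p) summable_on I"
      by (rule summable_on_comparison_test[OF that]) (use lo in auto)
    then show ?thesis
      using assms(2) by (simp add: summable_on_cmult_right')
  qed
  show "(\<lambda>i. norm (of_real (w i) * f i) powr p) summable_on I \<longleftrightarrow>
      (\<lambda>i. norm (f i) powr p) summable_on I"
    using fw bw by blast
  assume f: "(\<lambda>i. norm (f i) powr p) summable_on I"
  show "c powr p * (\<Sum>\<^sub>\<infinity>i\<in>I. norm (f i) powr p)
      \<le> (\<Sum>\<^sub>\<infinity>i\<in>I. norm (of_real (w i) * f i) powr p)"
    unfolding infsum_cmult_right'[symmetric]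
    by (rule infsum_mono[OF summable_on_cmult_right[OF f] fw[OF f] lo])
  show "(\<Sum>\<^sub>\<infinity>i\<in>I. norm (of_real (w i) * f i) powr p)
      \<le> C powr p * (\<Sum>\<^sub>\<infinity>i\<in>I. norm (f i) powr p)"
    unfolding infsum_cmult_right'[symmetric]
    by (rule infsum_mono[OF fw[OF f] summable_on_cmult_right[OF f] up])
qed

theorem theorem4p2:
  fixes smul :: "'k::real_normed_field \<Rightarrow> 'v::ab_group_add \<Rightarrow> 'v"
    and n :: nat
    and nnorm :: "'v list \<Rightarrow> real"
    and a :: "'v list"
    and p A B lam mu :: real
    and I :: "'i set"
    and T R :: "'i \<Rightarrow> 'v list \<Rightarrow> 'k"
    and \<alpha> \<beta> :: "'i \<Rightarrow> real"
  assumes "n_Banach_space smul n nnorm"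
    and "length a = n - 1"
    and "1 < p"
    and "countable I"
    and "p_frame_with_bounds smul nnorm a p I T A B"
    and "\<forall>i\<in>I. R i \<in> bounded_b_linear smul nnorm a"
    and "positively_confined I \<alpha>"
    and "positively_confined I \<beta>"
    and "0 \<le> lam" and "lam < 1 / 2 powr p"
    and "0 \<le> mu" and "mu < 1 / 2 powr p"
    and "\<And>x. (\<lambda>i. norm (of_real (\<alpha> i) * T i (x # a) - of_real (\<beta> i) * R i (x # a)) powr p)
                summable_on I"
    and "\<And>x. (\<Sum>\<^sub>\<infinity>i\<in>I. norm (of_real (\<alpha> i) * T i (x # a) - of_real (\<beta> i) * R i (x # a)) powr p)
              \<le> lam * (\<Sum>\<^sub>\<infinity>i\<in>I. norm (of_real (\<alpha> i) * T i (x # a)) powr p)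
                + mu * (\<Sum>\<^sub>\<infinity>i\<in>I. norm (of_real (\<beta> i) * R i (x # a)) powr p)"
  shows "p_frame smul nnorm a p I R"
proof -
  have p: "0 \<le> p" using assms(3) by simp
  obtain c C where \<alpha>: "0 < c" "0 < C" "\<forall>i\<in>I. c \<le> \<alpha> i \<and> \<alpha> i \<le> C"
    using positively_confined_bounds[OF assms(7)] by blast
  obtain d E where \<beta>: "0 < d" "0 < E" "\<forall>i\<in>I. d \<le> \<beta> i \<and> \<beta> i \<le> E"
    using positively_confined_bounds[OF assms(8)] by blast
  note T_weighted = powr_sum_weighted[OF p \<alpha>(1,3)]
  note R_weighted = powr_sum_weighted[OF p \<beta>(1,3)]
  have A: "0 < A" and B: "0 < B"
    and T_sum: "\<And>x. (\<lambda>i. norm (T i (x # a)) powr p) summable_on I"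
    and T_lo: "\<And>x. A * nnorm (x # a) powr p \<le> (\<Sum>\<^sub>\<infinity>i\<in>I. norm (T i (x # a)) powr p)"
    and T_up: "\<And>x. (\<Sum>\<^sub>\<infinity>i\<in>I. norm (T i (x # a)) powr p) \<le> B * nnorm (x # a) powr p"
    using assms(5) unfolding p_frame_with_bounds_def by auto
  define q where "q = 2 powr p"
  have q: "0 < q" unfolding q_def by simp
  have lam: "0 < 1 - q * lam" and mu: "0 < 1 - q * mu"
    using assms(10,12) q unfolding q_def by (simp_all add: field_simps)
  \<comment> \<open>Each bound is the ratio of the constants on the two sides of a chain of comparisons connecting
    \<open>nnorm (x # a) powr p\<close>, by way of \<open>PT\<close>, \<open>ST\<close> and \<open>SR\<close>, with \<open>PR\<close> below.\<close>
  define A' where "A' = (1 - q * lam) * c powr p * A / (q * (1 + mu) * E powr p)"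
  define B' where "B' = q * (1 + lam) * C powr p * B / ((1 - q * mu) * d powr p)"
  have A': "0 < A'" and B': "0 < B'"
    unfolding A'_def B'_def using A B q lam mu \<alpha>(1,2) \<beta>(1,2) assms(9,11) by simp_all
  have bounds: "(\<lambda>i. norm (R i (x # a)) powr p) summable_on I \<and>
      A' * nnorm (x # a) powr p \<le> (\<Sum>\<^sub>\<infinity>i\<in>I. norm (R i (x # a)) powr p) \<and>
      (\<Sum>\<^sub>\<infinity>i\<in>I. norm (R i (x # a)) powr p) \<le> B' * nnorm (x # a) powr p" for x
  proof -
    define N where "N = nnorm (x # a) powr p"
    define PT where "PT = (\<Sum>\<^sub>\<infinity>i\<in>I. norm (T i (x # a)) powr p)"
    define PR where "PR = (\<Sum>\<^sub>\<infinity>i\<in>I. norm (R i (x # a)) powr p)"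
    define ST where "ST = (\<Sum>\<^sub>\<infinity>i\<in>I. norm (of_real (\<alpha> i) * T i (x # a)) powr p)"
    define SR where "SR = (\<Sum>\<^sub>\<infinity>i\<in>I. norm (of_real (\<beta> i) * R i (x # a)) powr p)"
    define D where
      "D = (\<Sum>\<^sub>\<infinity>i\<in>I. norm (of_real (\<alpha> i) * T i (x # a) - of_real (\<beta> i) * R i (x # a)) powr p)"
    note D_sum = assms(13)[of x]
    have ST_sum: "(\<lambda>i. norm (of_real (\<alpha> i) * T i (x # a)) powr p) summable_on I"
      by (rule iffD2[OF T_weighted(1) T_sum])
    \<comment> \<open>Without this convergence \<open>SR\<close> would be \<open>0\<close> by default and the estimates for \<open>SR\<close> below
      would carry no information.\<close>
    have SR_sum: "(\<lambda>i. norm (of_real (\<beta> i) * R i (x # a)) powr p) summable_on I"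
      by (rule powr_summable_perturb[OF p D_sum ST_sum])
    have R_sum: "(\<lambda>i. norm (R i (x # a)) powr p) summable_on I"
      by (rule iffD1[OF R_weighted(1) SR_sum])
    have D_sum': "(\<lambda>i. norm (of_real (\<beta> i) * R i (x # a) - of_real (\<alpha> i) * T i (x # a)) powr p)
        summable_on I"
      using D_sum by (simp add: norm_minus_commute)
    have D: "D \<le> lam * ST + mu * SR"
      using assms(14)[of x] unfolding D_def ST_def SR_def .
    have "SR \<le> q * (D + ST)"
      unfolding q_def D_def ST_def SR_def by (rule powr_infsum_perturb[OF p D_sum ST_sum])
    also have "\<dots> \<le> q * (lam * ST + mu * SR + ST)"
      using D q by simp
    finally have SR: "(1 - q * mu) * SR \<le> q * (1 + lam) * ST"
      by (simp add: algebra_simps)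
    have "ST \<le> q * (D + SR)"
      using powr_infsum_perturb[OF p D_sum' SR_sum]
      unfolding q_def D_def ST_def SR_def by (simp add: norm_minus_commute)
    also have "\<dots> \<le> q * (lam * ST + mu * SR + SR)"
      using D q by simp
    finally have ST: "(1 - q * lam) * ST \<le> q * (1 + mu) * SR"
      by (simp add: algebra_simps)
    have "(1 - q * lam) * c powr p * A * N \<le> (1 - q * lam) * (c powr p * PT)"
      using T_lo[of x] lam unfolding N_def PT_def by (simp add: mult.assoc mult_left_mono)
    also have "\<dots> \<le> (1 - q * lam) * ST"
      using T_weighted(2)[OF T_sum[of x]] lam unfolding PT_def ST_def
      by (simp add: mult_left_mono)
    also note ST
    also have "q * (1 + mu) * SR \<le> q * (1 + mu) * (E powr p * PR)"
      using R_weighted(3)[OF R_sum] q assms(11) unfolding PR_def SR_def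
      by (simp add: mult_left_mono)
    finally have "(1 - q * lam) * c powr p * A * N \<le> PR * (q * (1 + mu) * E powr p)"
      by (simp add: mult_ac)
    moreover have "0 < q * (1 + mu) * E powr p"
      using q assms(11) \<beta>(2) by simp
    ultimately have lower: "A' * N \<le> PR"
      unfolding A'_def by (simp add: pos_divide_le_eq)
    have "(1 - q * mu) * (d powr p * PR) \<le> (1 - q * mu) * SR"
      using R_weighted(2)[OF R_sum] mu unfolding PR_def SR_def by (simp add: mult_left_mono)
    also note SR
    also have "q * (1 + lam) * ST \<le> q * (1 + lam) * (C powr p * PT)"
      using T_weighted(3)[OF T_sum[of x]] q assms(9) unfolding PT_def ST_def
      by (simp add: mult_left_mono)
    also have "\<dots> \<le> q * (1 + lam) * (C powr p * (B * N))"
      using T_up[of x] q assms(9) unfolding N_def PT_def by (simp add: mult_left_mono)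
    finally have "PR * ((1 - q * mu) * d powr p) \<le> q * (1 + lam) * C powr p * B * N"
      by (simp add: mult_ac)
    moreover have "0 < (1 - q * mu) * d powr p"
      using mu \<beta>(1) by simp
    ultimately have upper: "PR \<le> B' * N"
      unfolding B'_def by (simp add: pos_le_divide_eq)
    show ?thesis
      using R_sum lower upper unfolding N_def PR_def by blast
  qed
  have "p_frame_with_bounds smul nnorm a p I R A' B'"
    unfolding p_frame_with_bounds_def using assms(4,6) A' B' bounds by blast
  then show ?thesis
    unfolding p_frame_def by blast
qed

end
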